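(* Let $X$ and $Y$ be connected based CW-complexes. Then $$N\mathcal{E}(X\times Y)\geq \max\{N\mathcal{E}(X),N\mathcal{E}(Y)\}.$$
   Context: All spaces are based and have the based homotopy type of a CW-complex; all maps and homotopies preserve base points. For a connected space $X$, $[X,X]$ is the monoid (under composition) of based homotopy classes of based self-maps of $X$, and $\mathcal{E}(X)\subseteq[X,X]$ is the group of classes of self-homotopy equivalences. For a nonnegative integer $k$, $\mathcal{A}_\sharp^k(X)\subseteq[X,X]$ is the set of classes $f$ such that the induced map $\pi_i(f):\pi_i(X)\to\pi_i(X)$ is an isomorphism for all $i=0,1,\dots,k$. One always has $\mathcal{E}(X)\subseteq\mathcal{A}_\sharp^k(X)$. The self-closeness number of $X$ is $N\mathcal{E}(X)=\min\{k\geq 0 : \mathcal{A}_\sharp^k(X)=\mathcal{E}(X)\}$, with $N\mathcal{E}(X)=\infty$ if no such nonnegative integer $k$ exists. *)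

theory Defs
  imports "HOL-Analysis.Analysis" "HOL-Algebra.Group" "HOL-Library.Extended_Nat"
begin

section \<open>CW-complexes\<close>

text \<open>Points of \<^term>\<open>Euclidean_space n\<close> are the functions \<^typ>\<open>nat \<Rightarrow> real\<close> that vanish at
  all indices \<open>i \<ge> n\<close>. For \<open>n = 0\<close> the disc and the open disc are a point, and the bounding sphere is empty.\<close>

definition disc :: "nat \<Rightarrow> (nat \<Rightarrow> real) topology" where
  "disc n = subtopology (Euclidean_space n) {x. (\<Sum>i<n. (x i)\<^sup>2) \<le> 1}"

definition open_disc :: "nat \<Rightarrow> (nat \<Rightarrow> real) topology" where
  "open_disc n = subtopology (Euclidean_space n) {x. (\<Sum>i<n. (x i)\<^sup>2) < 1}"

definition disc_boundary :: "nat \<Rightarrow> (nat \<Rightarrow> real) set" where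
  "disc_boundary n = {x \<in> topspace (disc n). (\<Sum>i<n. (x i)\<^sup>2) = 1}"

text \<open>\<open>E\<close> is the set of open cells, \<open>d e\<close> the dimension and \<open>\<Phi> e\<close> a characteristic map of the
  cell \<open>e\<close>. The last two clauses are closure finiteness and the weak topology.\<close>

definition CW_structure ::
  "'a topology \<Rightarrow> 'a set set \<Rightarrow> ('a set \<Rightarrow> nat) \<Rightarrow> ('a set \<Rightarrow> (nat \<Rightarrow> real) \<Rightarrow> 'a) \<Rightarrow> bool" where
  "CW_structure X E d \<Phi> \<longleftrightarrow>
     Hausdorff_space X \<and>
     \<Union>E = topspace X \<and> pairwise disjnt E \<and>
     (\<forall>e\<in>E. continuous_map (disc (d e)) X (\<Phi> e) \<and>
            homeomorphic_map (open_disc (d e)) (subtopology X e) (\<Phi> e)) \<and>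
     (\<forall>e\<in>E. \<exists>F\<subseteq>E. finite F \<and> (\<forall>e'\<in>F. d e' < d e) \<and> \<Phi> e ` disc_boundary (d e) \<subseteq> \<Union>F) \<and>
     (\<forall>C\<subseteq>topspace X. (\<forall>e\<in>E. closedin X (C \<inter> X closure_of e)) \<longrightarrow> closedin X C)"

definition CW_complex :: "'a topology \<Rightarrow> bool" where
  "CW_complex X \<longleftrightarrow> (\<exists>E d \<Phi>. CW_structure X E d \<Phi>)"


section \<open>Based homotopy classes of maps\<close>

definition based_maps :: "'a topology \<Rightarrow> 'a \<Rightarrow> 'b topology \<Rightarrow> 'b \<Rightarrow> ('a \<Rightarrow> 'b) set" where
  "based_maps X x0 Y y0 = {f. continuous_map X Y f \<and> f x0 = y0}"

definition based_homotopic ::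
  "'a topology \<Rightarrow> 'a \<Rightarrow> 'b topology \<Rightarrow> 'b \<Rightarrow> (('a \<Rightarrow> 'b) \<times> ('a \<Rightarrow> 'b)) set" where
  "based_homotopic X x0 Y y0 = {(f, g). homotopic_with (\<lambda>h. h x0 = y0) X Y f g}"

text \<open>HOL functions are total, so the homotopy class of a map also contains the functions that differ
  from a member only outside of \<^term>\<open>topspace X\<close>.\<close>

definition based_classes :: "'a topology \<Rightarrow> 'a \<Rightarrow> 'b topology \<Rightarrow> 'b \<Rightarrow> ('a \<Rightarrow> 'b) set set" where
  "based_classes X x0 Y y0 = based_maps X x0 Y y0 // based_homotopic X x0 Y y0"

definition based_homotopy_equivalence ::
  "'a topology \<Rightarrow> 'a \<Rightarrow> 'b topology \<Rightarrow> 'b \<Rightarrow> ('a \<Rightarrow> 'b) \<Rightarrow> bool" where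
  "based_homotopy_equivalence X x0 Y y0 f \<longleftrightarrow>
     f \<in> based_maps X x0 Y y0 \<and>
     (\<exists>g \<in> based_maps Y y0 X x0.
        (g \<circ> f, id) \<in> based_homotopic X x0 X x0 \<and> (f \<circ> g, id) \<in> based_homotopic Y y0 Y y0)"


section \<open>Homotopy groups\<close>

definition cube :: "nat \<Rightarrow> (nat \<Rightarrow> real) topology" where
  "cube n = subtopology (Euclidean_space n) {x. \<forall>i<n. 0 \<le> x i \<and> x i \<le> 1}"

definition cube_boundary :: "nat \<Rightarrow> (nat \<Rightarrow> real) set" where
  "cube_boundary n = {x \<in> topspace (cube n). \<exists>i<n. x i = 0 \<or> x i = 1}"

definition spheroids :: "nat \<Rightarrow> 'a topology \<Rightarrow> 'a \<Rightarrow> ((nat \<Rightarrow> real) \<Rightarrow> 'a) set" where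
  "spheroids n X x0 = {u. continuous_map (cube n) X u \<and> (\<forall>x\<in>cube_boundary n. u x = x0)}"

definition spheroid_homotopic ::
  "nat \<Rightarrow> 'a topology \<Rightarrow> 'a \<Rightarrow> (((nat \<Rightarrow> real) \<Rightarrow> 'a) \<times> ((nat \<Rightarrow> real) \<Rightarrow> 'a)) set" where
  "spheroid_homotopic n X x0 =
     {(u, v). homotopic_with (\<lambda>h. \<forall>x\<in>cube_boundary n. h x = x0) (cube n) X u v}"

definition spheroid_join ::
  "((nat \<Rightarrow> real) \<Rightarrow> 'a) \<Rightarrow> ((nat \<Rightarrow> real) \<Rightarrow> 'a) \<Rightarrow> (nat \<Rightarrow> real) \<Rightarrow> 'a" where
  "spheroid_join u v x = (if x 0 \<le> 1/2 then u (x(0 := 2 * x 0)) else v (x(0 := 2 * x 0 - 1)))"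

text \<open>For \<open>n = 0\<close> only the carrier (the set of path components) and the distinguished element \<open>one\<close>
  (the component of the base point) are meaningful.\<close>

definition homotopy_group ::
  "nat \<Rightarrow> 'a topology \<Rightarrow> 'a \<Rightarrow> ((nat \<Rightarrow> real) \<Rightarrow> 'a) set monoid" where
  "homotopy_group n X x0 =
     \<lparr>carrier = spheroids n X x0 // spheroid_homotopic n X x0,
      mult = (\<lambda>A B. \<Union>u\<in>A. \<Union>v\<in>B. spheroid_homotopic n X x0 `` {spheroid_join u v}),
      one = spheroid_homotopic n X x0 `` {\<lambda>_. x0}\<rparr>"

definition homotopy_group_map ::
  "nat \<Rightarrow> 'b topology \<Rightarrow> 'b \<Rightarrow> ('a \<Rightarrow> 'b) \<Rightarrow> ((nat \<Rightarrow> real) \<Rightarrow> 'a) set \<Rightarrow> ((nat \<Rightarrow> real) \<Rightarrow> 'b) set" where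
  "homotopy_group_map n Y y0 f A = (\<Union>u\<in>A. spheroid_homotopic n Y y0 `` {f \<circ> u})"

definition induces_iso ::
  "nat \<Rightarrow> 'a topology \<Rightarrow> 'a \<Rightarrow> 'b topology \<Rightarrow> 'b \<Rightarrow> ('a \<Rightarrow> 'b) \<Rightarrow> bool" where
  "induces_iso n X x0 Y y0 f \<longleftrightarrow>
     (if n = 0
      then bij_betw (homotopy_group_map 0 Y y0 f)
             (carrier (homotopy_group 0 X x0)) (carrier (homotopy_group 0 Y y0)) \<and>
           homotopy_group_map 0 Y y0 f \<one>\<^bsub>homotopy_group 0 X x0\<^esub> = \<one>\<^bsub>homotopy_group 0 Y y0\<^esub>
      else homotopy_group_map n Y y0 f \<in> iso (homotopy_group n X x0) (homotopy_group n Y y0))"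


section \<open>The self-closeness number\<close>

text \<open>Both properties of \<open>f\<close> below are invariant under based homotopy, so it does not matter which
  representative of the class is used.\<close>

definition self_equivalences :: "'a topology \<Rightarrow> 'a \<Rightarrow> ('a \<Rightarrow> 'a) set set" where
  "self_equivalences X x0 =
     {F \<in> based_classes X x0 X x0. \<exists>f\<in>F. based_homotopy_equivalence X x0 X x0 f}"

definition A_sharp :: "nat \<Rightarrow> 'a topology \<Rightarrow> 'a \<Rightarrow> ('a \<Rightarrow> 'a) set set" where
  "A_sharp k X x0 =
     {F \<in> based_classes X x0 X x0. \<exists>f\<in>F. \<forall>i\<le>k. induces_iso i X x0 X x0 f}"

definition self_closeness_number :: "'a topology \<Rightarrow> 'a \<Rightarrow> enat" where
  "self_closeness_number X x0 =
     (if \<exists>k. A_sharp k X x0 = self_equivalences X x0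
      then enat (LEAST k. A_sharp k X x0 = self_equivalences X x0)
      else \<infinity>)"

end

theory Submission
  imports Defs
begin

text \<open>
  Let \<open>f\<close> be a self-map of \<open>X\<close>. On homotopy groups \<open>f \<times> id\<close> acts on
  \<open>\<pi>\<^sub>i(X \<times> Y) = \<pi>\<^sub>i(X) \<times> \<pi>\<^sub>i(Y)\<close> by \<open>\<pi>\<^sub>i(f) \<times> id\<close>, so it is an isomorphism in every degree in
  which \<open>f\<close> is one (\<open>induces_iso_map_prod\<close>). Suppose that on \<open>X \<times> Y\<close> isomorphisms in degrees up to
  \<open>k\<close> detect homotopy equivalences, and that \<open>f\<close> is an isomorphism in these degrees. Then
  \<open>f \<times> id\<close> has a homotopy inverse \<open>G\<close>. To go back to \<open>f\<close>, take
  the inclusion \<open>i x = (x, y\<^sub>0)\<close> and the projection \<open>p\<close> to \<open>X\<close>. Then \<open>p \<circ> i = id\<close>,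
  \<open>(f \<times> id) \<circ> i = i \<circ> f\<close> and \<open>p \<circ> (f \<times> id) = f \<circ> p\<close>, hence
  \<open>(p \<circ> G \<circ> i) \<circ> f = p \<circ> G \<circ> (f \<times> id) \<circ> i \<simeq> p \<circ> i = id\<close> and
  \<open>f \<circ> (p \<circ> G \<circ> i) = p \<circ> (f \<times> id) \<circ> G \<circ> i \<simeq> p \<circ> i = id\<close>,
  so that \<open>p \<circ> G \<circ> i\<close> is a homotopy inverse of \<open>f\<close> (\<open>based_homotopy_equivalence_retract\<close>). So every
  \<open>k\<close> that is admissible for \<open>X \<times> Y\<close> is admissible for \<open>X\<close>, and in the same way for \<open>Y\<close>.

  That admissibility of \<open>k\<close> is exactly this detection property also requires that homotopy
  equivalences induce isomorphisms in all degrees (\<open>based_homotopy_equivalence_induces_iso\<close>), which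
  is functoriality and homotopy invariance of \<open>\<pi>\<^sub>i\<close>. To treat both factors at once,
  \<open>self_closeness_number_retract\<close> compares a space with a retract of it to which self-maps
  extend compatibly with the inclusion, the retraction and isomorphisms on homotopy groups.
\<close>

section \<open>Based maps and their homotopies\<close>

lemma homotopic_with_Pair:
  assumes "homotopic_with P Z X f f'" and "homotopic_with Q Z Y g g'"
    and R: "\<And>h k. P h \<Longrightarrow> Q k \<Longrightarrow> R (\<lambda>z. (h z, k z))"
  shows "homotopic_with R Z (prod_topology X Y) (\<lambda>z. (f z, g z)) (\<lambda>z. (f' z, g' z))"
proof -
  let ?I = "top_of_set {0..1::real}"
  obtain h where h: "continuous_map (prod_topology ?I Z) X h"
      "\<And>z. h (0, z) = f z" "\<And>z. h (1, z) = f' z" "\<And>t. t \<in> {0..1} \<Longrightarrow> P (\<lambda>z. h (t, z))"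
    using assms(1) unfolding homotopic_with_def by auto
  obtain k where k: "continuous_map (prod_topology ?I Z) Y k"
      "\<And>z. k (0, z) = g z" "\<And>z. k (1, z) = g' z" "\<And>t. t \<in> {0..1} \<Longrightarrow> Q (\<lambda>z. k (t, z))"
    using assms(2) unfolding homotopic_with_def by auto
  have "continuous_map (prod_topology ?I Z) (prod_topology X Y) (\<lambda>z. (h z, k z))"
    using h(1) k(1) by (simp add: continuous_map_pairwise o_def)
  then show ?thesis
    unfolding homotopic_with_def using h k R
    by (intro exI[of _ "\<lambda>z. (h z, k z)"]) auto
qed

lemma based_maps_comp:
  assumes "f \<in> based_maps X x0 Y y0" and "g \<in> based_maps Y y0 Z z0"
  shows "g \<circ> f \<in> based_maps X x0 Z z0"
  using assms by (auto simp: based_maps_def intro: continuous_map_compose)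

lemma id_in_based_maps: "id \<in> based_maps X x0 X x0"
  by (simp add: based_maps_def)

lemma based_homotopicD:
  assumes "(f, g) \<in> based_homotopic X x0 Y y0"
  shows "f \<in> based_maps X x0 Y y0" and "g \<in> based_maps X x0 Y y0"
  using homotopic_with_imp_continuous_maps[of _ X Y f g]
    homotopic_with_imp_property[of _ X Y f g] assms
  unfolding based_homotopic_def based_maps_def by blast+

lemma equiv_based_homotopic: "equiv (based_maps X x0 Y y0) (based_homotopic X x0 Y y0)"
proof (rule equivI)
  show "based_homotopic X x0 Y y0 \<subseteq> based_maps X x0 Y y0 \<times> based_maps X x0 Y y0"
    using based_homotopicD by fastforce
  show "refl_on (based_maps X x0 Y y0) (based_homotopic X x0 Y y0)"
    by (auto simp: refl_on_def based_maps_def based_homotopic_def)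
  show "sym (based_homotopic X x0 Y y0)"
    by (auto simp: sym_def based_homotopic_def intro: homotopic_with_symD)
  show "trans (based_homotopic X x0 Y y0)"
    by (auto simp: trans_def based_homotopic_def intro: homotopic_with_trans)
qed

lemma based_homotopic_sym:
  "(f, g) \<in> based_homotopic X x0 Y y0 \<Longrightarrow> (g, f) \<in> based_homotopic X x0 Y y0"
  using equiv_based_homotopic by (metis equivE symD)

lemma based_homotopic_trans:
  "(f, g) \<in> based_homotopic X x0 Y y0 \<Longrightarrow> (g, h) \<in> based_homotopic X x0 Y y0 \<Longrightarrow> (f, h) \<in> based_homotopic X x0 Y y0"
  using equiv_based_homotopic by (metis equivE transD)

lemma based_homotopic_comp:
  assumes "(f, g) \<in> based_homotopic X x0 Y y0"
    and "a \<in> based_maps W w0 X x0" and "b \<in> based_maps Y y0 Z z0"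
  shows "(b \<circ> f \<circ> a, b \<circ> g \<circ> a) \<in> based_homotopic W w0 Z z0"
proof -
  have "homotopic_with (\<lambda>h. h x0 = z0) X Z (b \<circ> f) (b \<circ> g)"
    using assms
    by (auto simp: based_homotopic_def based_maps_def
        intro: homotopic_with_compose_continuous_map_left)
  then show ?thesis
    using assms(2)
    by (auto simp: based_homotopic_def based_maps_def
        intro: homotopic_with_compose_continuous_map_right)
qed

lemma based_homotopy_equivalence_homotopic:
  assumes "based_homotopy_equivalence X x0 Y y0 f" and fg: "(f, g) \<in> based_homotopic X x0 Y y0"
  shows "based_homotopy_equivalence X x0 Y y0 g"
proof -
  obtain k where k: "k \<in> based_maps Y y0 X x0" "(k \<circ> f, id) \<in> based_homotopic X x0 X x0"
      "(f \<circ> k, id) \<in> based_homotopic Y y0 Y y0"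
    using assms(1) unfolding based_homotopy_equivalence_def by blast
  have "(k \<circ> g, k \<circ> f) \<in> based_homotopic X x0 X x0" "(g \<circ> k, f \<circ> k) \<in> based_homotopic Y y0 Y y0"
    using based_homotopic_comp[OF based_homotopic_sym[OF fg] id_in_based_maps k(1)]
      based_homotopic_comp[OF based_homotopic_sym[OF fg] k(1) id_in_based_maps] by simp_all
  then have "(k \<circ> g, id) \<in> based_homotopic X x0 X x0" "(g \<circ> k, id) \<in> based_homotopic Y y0 Y y0"
    using k(2,3) based_homotopic_trans by metis+
  then show ?thesis
    unfolding based_homotopy_equivalence_def
    using k(1) based_homotopicD(2)[OF fg] by blast
qed

text \<open>Writing \<open>G\<close> for a homotopy inverse of \<open>F\<close>, the map \<open>p \<circ> G \<circ> i\<close> is a homotopy inverse of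
  \<open>f\<close>: since \<open>F\<close> commutes with both \<open>i\<close> and \<open>p\<close>, the two composites are \<open>p \<circ> (G \<circ> F) \<circ> i\<close> and
  \<open>p \<circ> (F \<circ> G) \<circ> i\<close>.\<close>

lemma based_homotopy_equivalence_retract:
  assumes i: "i \<in> based_maps X x0 Z z0" and p: "p \<in> based_maps Z z0 X x0" and "p \<circ> i = id"
    and Fi: "F \<circ> i = i \<circ> f" and pF: "p \<circ> F = f \<circ> p"
    and "based_homotopy_equivalence Z z0 Z z0 F"
  shows "based_homotopy_equivalence X x0 X x0 f"
proof -
  obtain G where F: "F \<in> based_maps Z z0 Z z0" and G: "G \<in> based_maps Z z0 Z z0"
      and GF: "(G \<circ> F, id) \<in> based_homotopic Z z0 Z z0"
      and FG: "(F \<circ> G, id) \<in> based_homotopic Z z0 Z z0"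
    using assms(6) unfolding based_homotopy_equivalence_def by blast
  have "f = p \<circ> (F \<circ> i)"
    using Fi \<open>p \<circ> i = id\<close> by (metis comp_assoc id_comp)
  then have "f \<in> based_maps X x0 X x0"
    using i p F by (blast intro: based_maps_comp)
  moreover have "p \<circ> G \<circ> i \<in> based_maps X x0 X x0"
    using i p G by (blast intro: based_maps_comp)
  moreover have "p \<circ> G \<circ> i \<circ> f = p \<circ> (G \<circ> F) \<circ> i" "f \<circ> (p \<circ> G \<circ> i) = p \<circ> (F \<circ> G) \<circ> i"
    using Fi pF by (metis comp_assoc)+
  moreover have "(p \<circ> (G \<circ> F) \<circ> i, id) \<in> based_homotopic X x0 X x0"
      "(p \<circ> (F \<circ> G) \<circ> i, id) \<in> based_homotopic X x0 X x0"
    using based_homotopic_comp[OF GF i p] based_homotopic_comp[OF FG i p] \<open>p \<circ> i = id\<close> by simp_all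
  ultimately show ?thesis
    unfolding based_homotopy_equivalence_def by metis
qed


section \<open>Spheroids and induced maps on homotopy groups\<close>

lemma spheroid_homotopicD:
  assumes "(u, v) \<in> spheroid_homotopic n X x0"
  shows "u \<in> spheroids n X x0" and "v \<in> spheroids n X x0"
  using homotopic_with_imp_continuous_maps[of _ "cube n" X u v]
    homotopic_with_imp_property[of _ "cube n" X u v] assms
  unfolding spheroid_homotopic_def spheroids_def by blast+

lemma equiv_spheroid_homotopic: "equiv (spheroids n X x0) (spheroid_homotopic n X x0)"
proof (rule equivI)
  show "spheroid_homotopic n X x0 \<subseteq> spheroids n X x0 \<times> spheroids n X x0"
    using spheroid_homotopicD by fastforce
  show "refl_on (spheroids n X x0) (spheroid_homotopic n X x0)"
    by (auto simp: refl_on_def spheroids_def spheroid_homotopic_def)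
  show "sym (spheroid_homotopic n X x0)"
    by (auto simp: sym_def spheroid_homotopic_def intro: homotopic_with_symD)
  show "trans (spheroid_homotopic n X x0)"
    by (auto simp: trans_def spheroid_homotopic_def intro: homotopic_with_trans)
qed

lemma spheroid_homotopic_refl:
  "u \<in> spheroids n X x0 \<Longrightarrow> (u, u) \<in> spheroid_homotopic n X x0"
  by (simp add: spheroids_def spheroid_homotopic_def)

lemma spheroid_homotopic_sym:
  "(f, g) \<in> spheroid_homotopic n X x0 \<Longrightarrow> (g, f) \<in> spheroid_homotopic n X x0"
  using equiv_spheroid_homotopic by (metis equivE symD)

lemma spheroid_homotopic_trans:
  "(f, g) \<in> spheroid_homotopic n X x0 \<Longrightarrow> (g, h) \<in> spheroid_homotopic n X x0 \<Longrightarrow> (f, h) \<in> spheroid_homotopic n X x0"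
  using equiv_spheroid_homotopic by (metis equivE transD)

lemma spheroid_comp:
  assumes "f \<in> based_maps X x0 Y y0" and "u \<in> spheroids n X x0"
  shows "f \<circ> u \<in> spheroids n Y y0"
  using assms by (auto simp: based_maps_def spheroids_def intro: continuous_map_compose)

lemma spheroid_homotopic_comp:
  assumes "f \<in> based_maps X x0 Y y0" and "(u, v) \<in> spheroid_homotopic n X x0"
  shows "(f \<circ> u, f \<circ> v) \<in> spheroid_homotopic n Y y0"
  using assms
  by (auto simp: based_maps_def spheroid_homotopic_def
      intro: homotopic_with_compose_continuous_map_left)

lemma spheroid_homotopic_comp_left:
  assumes "(f, g) \<in> based_homotopic X x0 Y y0" and "u \<in> spheroids n X x0"
  shows "(f \<circ> u, g \<circ> u) \<in> spheroid_homotopic n Y y0"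
  using assms
  by (auto simp: based_homotopic_def spheroids_def spheroid_homotopic_def
      intro: homotopic_with_compose_continuous_map_right)

text \<open>The concatenation of spheroids descends to homotopy classes, because two homotopies can be
  concatenated at each time \<open>t\<close>. The result is continuous since both pieces are continuous on the
  closed half cubes, and on the common face both are constant at the base point.\<close>

lemma spheroid_join_homotopic:
  assumes "n > 0" and "(u, u') \<in> spheroid_homotopic n X x0" and "(v, v') \<in> spheroid_homotopic n X x0"
  shows "(spheroid_join u v, spheroid_join u' v') \<in> spheroid_homotopic n X x0"
proof -
  let ?I = "top_of_set {0..1::real}"
  let ?IC = "prod_topology ?I (cube n)"
  obtain h where h: "continuous_map ?IC X h" "\<And>x. h (0, x) = u x" "\<And>x. h (1, x) = u' x"
      and hb: "\<And>t x. t \<in> {0..1} \<Longrightarrow> x \<in> cube_boundary n \<Longrightarrow> h (t, x) = x0"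
    using assms(2) unfolding spheroid_homotopic_def homotopic_with_def by auto
  obtain k where k: "continuous_map ?IC X k" "\<And>x. k (0, x) = v x" "\<And>x. k (1, x) = v' x"
      and kb: "\<And>t x. t \<in> {0..1} \<Longrightarrow> x \<in> cube_boundary n \<Longrightarrow> k (t, x) = x0"
    using assms(3) unfolding spheroid_homotopic_def homotopic_with_def by auto
  have top_cube: "topspace (cube n) = {x. (\<forall>i\<ge>n. x i = 0) \<and> (\<forall>i<n. 0 \<le> x i \<and> x i \<le> 1)}"
    by (auto simp: cube_def topspace_Euclidean_space)
  have cube_eq: "cube n = subtopology (powertop_real UNIV) (topspace (cube n))"
    by (simp add: top_cube cube_def Euclidean_space_def subtopology_subtopology Collect_conj_eq)
  have coord: "continuous_map ?IC euclideanreal (\<lambda>z. snd z i)" for i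
  proof -
    have "continuous_map (cube n) euclideanreal (\<lambda>x. x i)"
      unfolding cube_def Euclidean_space_def
      by (intro continuous_map_from_subtopology continuous_map_product_projection) simp
    then show ?thesis
      using continuous_map_compose[OF continuous_map_snd, of "cube n" euclideanreal "\<lambda>x. x i" ?I]
      by (simp add: o_def)
  qed
  \<comment> \<open>Stretching the first coordinate maps the lower (\<open>c = 0\<close>) or upper (\<open>c = 1\<close>) half of the cube,
    in the role of \<open>S\<close>, to the whole cube.\<close>
  have rescale: "continuous_map (subtopology ?IC S) ?IC
      (\<lambda>z. (fst z, (snd z)(0 := 2 * snd z 0 - c)))"
    if S: "\<And>z. z \<in> topspace ?IC \<Longrightarrow> z \<in> S \<Longrightarrow> 0 \<le> 2 * snd z 0 - c \<and> 2 * snd z 0 - c \<le> 1"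
    for S c
  proof -
    have "continuous_map ?IC euclideanreal (\<lambda>z. ((snd z)(0 := 2 * snd z 0 - c)) i)" for i
      by (cases "i = 0") (auto intro!: continuous_intros coord)
    then have "continuous_map ?IC (powertop_real UNIV) (\<lambda>z. (snd z)(0 := 2 * snd z 0 - c))"
      by (simp add: continuous_map_componentwise_UNIV)
    then have "continuous_map (subtopology ?IC S) (powertop_real UNIV) (\<lambda>z. (snd z)(0 := 2 * snd z 0 - c))"
      by (rule continuous_map_from_subtopology)
    moreover have "(snd z)(0 := 2 * snd z 0 - c) \<in> topspace (cube n)"
      if "z \<in> topspace (subtopology ?IC S)" for z
      using S[of z] that \<open>n > 0\<close> by (auto simp: top_cube)
    ultimately have "continuous_map (subtopology ?IC S) (cube n) (\<lambda>z. (snd z)(0 := 2 * snd z 0 - c))"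
      by (subst cube_eq) (auto simp: continuous_map_in_subtopology)
    moreover have "continuous_map (subtopology ?IC S) ?I fst"
      by (intro continuous_map_from_subtopology continuous_map_fst)
    ultimately show ?thesis
      by (simp add: continuous_map_pairwise o_def)
  qed
  let ?H = "\<lambda>z. if snd z 0 \<le> 1/2 then h (fst z, (snd z)(0 := 2 * snd z 0))
                 else k (fst z, (snd z)(0 := 2 * snd z 0 - 1))"
  have "continuous_map ?IC X ?H"
  proof (rule continuous_map_cases_le)
    show "continuous_map (subtopology ?IC {z \<in> topspace ?IC. snd z 0 \<le> 1/2}) X
        (\<lambda>z. h (fst z, (snd z)(0 := 2 * snd z 0)))"
    proof -
      have "continuous_map (subtopology ?IC {z \<in> topspace ?IC. snd z 0 \<le> 1/2}) ?IC
          (\<lambda>z. (fst z, (snd z)(0 := 2 * snd z 0 - 0)))"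
        using \<open>n > 0\<close> by (intro rescale) (auto simp: top_cube)
      from continuous_map_compose[OF this h(1)] show ?thesis
        by (simp add: o_def)
    qed
    show "continuous_map (subtopology ?IC {z \<in> topspace ?IC. 1/2 \<le> snd z 0}) X
        (\<lambda>z. k (fst z, (snd z)(0 := 2 * snd z 0 - 1)))"
    proof -
      have "continuous_map (subtopology ?IC {z \<in> topspace ?IC. 1/2 \<le> snd z 0}) ?IC
          (\<lambda>z. (fst z, (snd z)(0 := 2 * snd z 0 - 1)))"
        using \<open>n > 0\<close> by (intro rescale) (auto simp: top_cube)
      from continuous_map_compose[OF this k(1)] show ?thesis
        by (simp add: o_def)
    qed
    fix z assume "z \<in> topspace ?IC" "snd z 0 = 1/2"
    then have "fst z \<in> {0..1}" "(snd z)(0 := 1) \<in> cube_boundary n" "(snd z)(0 := 0) \<in> cube_boundary n"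
      using \<open>n > 0\<close> by (auto simp: cube_boundary_def top_cube)
    then show "h (fst z, (snd z)(0 := 2 * snd z 0)) = k (fst z, (snd z)(0 := 2 * snd z 0 - 1))"
      using hb kb unfolding \<open>snd z 0 = 1/2\<close> by simp
  qed (auto intro: coord)
  moreover have "?H (t, x) = x0" if t: "t \<in> {0..1}" and x: "x \<in> cube_boundary n" for t x
  proof -
    obtain i where i: "i < n" "x i = 0 \<or> x i = 1"
      using x by (auto simp: cube_boundary_def)
    show ?thesis
    proof (cases "x 0 \<le> 1/2")
      case True
      have "(x(0 := 2 * x 0)) i = 0 \<or> (x(0 := 2 * x 0)) i = 1"
        using i True by (cases "i = 0") auto
      moreover have "x(0 := 2 * x 0) \<in> topspace (cube n)"
        using x True \<open>n > 0\<close> by (auto simp: cube_boundary_def top_cube)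
      ultimately have "x(0 := 2 * x 0) \<in> cube_boundary n"
        using i(1) unfolding cube_boundary_def by blast
      then show ?thesis
        using True hb t by simp
    next
      case False
      have "(x(0 := 2 * x 0 - 1)) i = 0 \<or> (x(0 := 2 * x 0 - 1)) i = 1"
        using i False by (cases "i = 0") auto
      moreover have "x(0 := 2 * x 0 - 1) \<in> topspace (cube n)"
        using x False \<open>n > 0\<close> by (auto simp: cube_boundary_def top_cube)
      ultimately have "x(0 := 2 * x 0 - 1) \<in> cube_boundary n"
        using i(1) unfolding cube_boundary_def by blast
      then show ?thesis
        using False kb t by simp
    qed
  qed
  ultimately have "homotopic_with (\<lambda>h. \<forall>x\<in>cube_boundary n. h x = x0) (cube n) X
      (spheroid_join u v) (spheroid_join u' v')"
    unfolding homotopic_with_def using h(2,3) k(2,3)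
    by (intro exI[of _ ?H]) (auto simp: spheroid_join_def)
  then show ?thesis
    by (simp add: spheroid_homotopic_def)
qed

lemma comp_spheroid_join: "f \<circ> spheroid_join u v = spheroid_join (f \<circ> u) (f \<circ> v)"
  by (auto simp: spheroid_join_def fun_eq_iff)

lemma mult_homotopy_group:
  assumes "n > 0" and "u \<in> spheroids n X x0" and "v \<in> spheroids n X x0"
  shows "mult (homotopy_group n X x0) (spheroid_homotopic n X x0 `` {u}) (spheroid_homotopic n X x0 `` {v})
      = spheroid_homotopic n X x0 `` {spheroid_join u v}"
proof -
  have "(\<lambda>u v. spheroid_homotopic n X x0 `` {spheroid_join u v}) respects2 spheroid_homotopic n X x0"
    by (rule congruent2I')
      (auto intro!: equiv_class_eq[OF equiv_spheroid_homotopic] spheroid_join_homotopic assms(1))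
  from UN_equiv_class2[OF equiv_spheroid_homotopic equiv_spheroid_homotopic this assms(2,3)]
  show ?thesis
    by (simp add: homotopy_group_def)
qed

lemma homotopy_group_map_class:
  assumes "f \<in> based_maps X x0 Y y0" and "u \<in> spheroids n X x0"
  shows "homotopy_group_map n Y y0 f (spheroid_homotopic n X x0 `` {u})
      = spheroid_homotopic n Y y0 `` {f \<circ> u}"
proof -
  have "(\<lambda>u. spheroid_homotopic n Y y0 `` {f \<circ> u}) respects spheroid_homotopic n X x0"
    by (auto intro!: congruentI equiv_class_eq[OF equiv_spheroid_homotopic]
        spheroid_homotopic_comp assms(1))
  from UN_equiv_class[OF equiv_spheroid_homotopic this assms(2)]
  show ?thesis
    by (simp add: homotopy_group_map_def)
qed

lemma homotopy_group_map_hom: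
  assumes f: "f \<in> based_maps X x0 Y y0" and "n > 0"
  shows "homotopy_group_map n Y y0 f \<in> hom (homotopy_group n X x0) (homotopy_group n Y y0)"
proof (rule homI)
  fix A assume "A \<in> carrier (homotopy_group n X x0)"
  then obtain u where "u \<in> spheroids n X x0" "A = spheroid_homotopic n X x0 `` {u}"
    by (auto simp: homotopy_group_def elim: quotientE)
  then show "homotopy_group_map n Y y0 f A \<in> carrier (homotopy_group n Y y0)"
    using f by (auto simp: homotopy_group_map_class spheroid_comp homotopy_group_def intro: quotientI)
  fix B assume "B \<in> carrier (homotopy_group n X x0)"
  then obtain v where "v \<in> spheroids n X x0" "B = spheroid_homotopic n X x0 `` {v}"
    by (auto simp: homotopy_group_def elim: quotientE)
  moreover have "spheroid_join u v \<in> spheroids n X x0"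
    using spheroid_homotopicD(1) spheroid_join_homotopic[OF \<open>n > 0\<close>] spheroid_homotopic_refl
      \<open>u \<in> _\<close> \<open>v \<in> _\<close> by metis
  ultimately show "homotopy_group_map n Y y0 f (A \<otimes>\<^bsub>homotopy_group n X x0\<^esub> B) =
      homotopy_group_map n Y y0 f A \<otimes>\<^bsub>homotopy_group n Y y0\<^esub> homotopy_group_map n Y y0 f B"
    using f \<open>n > 0\<close> \<open>u \<in> _\<close> \<open>A = _\<close>
    by (simp add: mult_homotopy_group homotopy_group_map_class spheroid_comp comp_spheroid_join)
qed

text \<open>The induced maps always preserve the algebraic structure, so that only bijectivity on classes
  is at stake. The criterion expresses it by representatives; degree \<open>0\<close>, where there is no group
  structure, needs no separate treatment from here on.\<close>

lemma induces_iso_iff: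
  assumes f: "f \<in> based_maps X x0 Y y0" and x0: "x0 \<in> topspace X"
  shows "induces_iso n X x0 Y y0 f \<longleftrightarrow>
    (\<forall>u\<in>spheroids n X x0. \<forall>v\<in>spheroids n X x0.
       (f \<circ> u, f \<circ> v) \<in> spheroid_homotopic n Y y0 \<longrightarrow> (u, v) \<in> spheroid_homotopic n X x0) \<and>
    (\<forall>w\<in>spheroids n Y y0. \<exists>u\<in>spheroids n X x0. (f \<circ> u, w) \<in> spheroid_homotopic n Y y0)"
    (is "_ \<longleftrightarrow> ?inj \<and> ?surj")
proof -
  let ?m = "homotopy_group_map n Y y0 f"
  let ?C = "carrier (homotopy_group n X x0)" and ?D = "carrier (homotopy_group n Y y0)"
  have C: "?C = (\<lambda>u. spheroid_homotopic n X x0 `` {u}) ` spheroids n X x0"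
    and D: "?D = (\<lambda>u. spheroid_homotopic n Y y0 `` {u}) ` spheroids n Y y0"
    by (auto simp: homotopy_group_def quotient_def)
  have "inj_on ?m ?C \<longleftrightarrow> ?inj"
    unfolding inj_on_def C using f
    by (simp add: homotopy_group_map_class eq_equiv_class_iff[OF equiv_spheroid_homotopic] spheroid_comp)
  moreover have "?m ` ?C = ?D \<longleftrightarrow> ?surj"
  proof -
    have "?m ` ?C \<subseteq> ?D"
      unfolding C D using f by (auto simp: homotopy_group_map_class spheroid_comp)
    moreover have "?D \<subseteq> ?m ` ?C \<longleftrightarrow> ?surj"
    proof -
      have "?D \<subseteq> ?m ` ?C \<longleftrightarrow> (\<forall>w\<in>spheroids n Y y0. \<exists>u\<in>spheroids n X x0.
          spheroid_homotopic n Y y0 `` {f \<circ> u} = spheroid_homotopic n Y y0 `` {w})"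
        unfolding C D image_image using f
        by (simp add: homotopy_group_map_class image_subset_iff image_iff eq_commute)
      then show ?thesis
        using f by (simp add: eq_equiv_class_iff[OF equiv_spheroid_homotopic] spheroid_comp)
    qed
    ultimately show ?thesis by auto
  qed
  ultimately have bij: "bij_betw ?m ?C ?D \<longleftrightarrow> ?inj \<and> ?surj"
    by (simp add: bij_betw_def)
  show ?thesis
  proof (cases "n = 0")
    case True
    have "(\<lambda>_. x0) \<in> spheroids 0 X x0"
      using x0 by (simp add: spheroids_def)
    then have "homotopy_group_map 0 Y y0 f \<one>\<^bsub>homotopy_group 0 X x0\<^esub> = \<one>\<^bsub>homotopy_group 0 Y y0\<^esub>"
      using homotopy_group_map_class[OF f] f by (simp add: homotopy_group_def based_maps_def o_def)
    then show ?thesis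
      using bij True by (simp add: induces_iso_def)
  next
    case False
    then show ?thesis
      using bij homotopy_group_map_hom[OF f] by (simp add: induces_iso_def iso_def)
  qed
qed

lemma induces_iso_homotopic:
  assumes x0: "x0 \<in> topspace X" and fg: "(f, g) \<in> based_homotopic X x0 Y y0"
    and "induces_iso n X x0 Y y0 f"
  shows "induces_iso n X x0 Y y0 g"
proof -
  note hom = spheroid_homotopic_comp_left[OF fg]
  have iso: "\<And>u v. u \<in> spheroids n X x0 \<Longrightarrow> v \<in> spheroids n X x0 \<Longrightarrow>
        (f \<circ> u, f \<circ> v) \<in> spheroid_homotopic n Y y0 \<Longrightarrow> (u, v) \<in> spheroid_homotopic n X x0"
      "\<And>w. w \<in> spheroids n Y y0 \<Longrightarrow> \<exists>u\<in>spheroids n X x0. (f \<circ> u, w) \<in> spheroid_homotopic n Y y0"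
    using assms(3) induces_iso_iff[OF based_homotopicD(1)[OF fg] x0] by blast+
  show ?thesis
    unfolding induces_iso_iff[OF based_homotopicD(2)[OF fg] x0]
    using iso hom spheroid_homotopic_sym spheroid_homotopic_trans by meson
qed

lemma induces_iso_id:
  assumes "x0 \<in> topspace X"
  shows "induces_iso n X x0 X x0 id"
  using induces_iso_iff[OF id_in_based_maps assms, of n] spheroid_homotopic_refl by fastforce

text \<open>A homotopy inverse \<open>g\<close> of \<open>f\<close> induces the inverse map: \<open>u \<simeq> g \<circ> (f \<circ> u)\<close> recovers the class of
  \<open>u\<close> from that of \<open>f \<circ> u\<close>, and \<open>g \<circ> w\<close> is a preimage of the class of \<open>w\<close>.\<close>

lemma based_homotopy_equivalence_induces_iso:
  assumes "based_homotopy_equivalence X x0 Y y0 f" and x0: "x0 \<in> topspace X"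
  shows "induces_iso n X x0 Y y0 f"
proof -
  obtain g where f: "f \<in> based_maps X x0 Y y0" and g: "g \<in> based_maps Y y0 X x0"
      and gf: "(g \<circ> f, id) \<in> based_homotopic X x0 X x0"
      and fg: "(f \<circ> g, id) \<in> based_homotopic Y y0 Y y0"
    using assms unfolding based_homotopy_equivalence_def by blast
  have gfu: "(g \<circ> (f \<circ> u), u) \<in> spheroid_homotopic n X x0" if "u \<in> spheroids n X x0" for u
    using spheroid_homotopic_comp_left[OF gf that] by (simp add: comp_assoc)
  have fgw: "(f \<circ> (g \<circ> w), w) \<in> spheroid_homotopic n Y y0" if "w \<in> spheroids n Y y0" for w
    using spheroid_homotopic_comp_left[OF fg that] by (simp add: comp_assoc)
  show ?thesis
    unfolding induces_iso_iff[OF f x0]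
  proof (intro conjI ballI impI)
    fix u v assume "u \<in> spheroids n X x0" "v \<in> spheroids n X x0"
      and "(f \<circ> u, f \<circ> v) \<in> spheroid_homotopic n Y y0"
    then show "(u, v) \<in> spheroid_homotopic n X x0"
      using gfu spheroid_homotopic_comp[OF g] spheroid_homotopic_sym spheroid_homotopic_trans by meson
  next
    fix w assume "w \<in> spheroids n Y y0"
    then show "\<exists>u\<in>spheroids n X x0. (f \<circ> u, w) \<in> spheroid_homotopic n Y y0"
      using fgw spheroid_comp[OF g] by blast
  qed
qed


section \<open>Products\<close>

lemma fst_in_based_maps: "fst \<in> based_maps (prod_topology X Y) (x0, y0) X x0"
  and snd_in_based_maps: "snd \<in> based_maps (prod_topology X Y) (x0, y0) Y y0"
  by (simp_all add: based_maps_def continuous_map_fst continuous_map_snd)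

lemma map_prod_in_based_maps:
  assumes "f \<in> based_maps X x0 X' x0'" and "g \<in> based_maps Y y0 Y' y0'"
  shows "map_prod f g \<in> based_maps (prod_topology X Y) (x0, y0) (prod_topology X' Y') (x0', y0')"
  using assms
  by (auto simp: based_maps_def map_prod_def continuous_map_prod_top)

lemma spheroid_homotopic_prod_iff:
  "(u, v) \<in> spheroid_homotopic n (prod_topology X Y) (x0, y0) \<longleftrightarrow>
     (fst \<circ> u, fst \<circ> v) \<in> spheroid_homotopic n X x0 \<and> (snd \<circ> u, snd \<circ> v) \<in> spheroid_homotopic n Y y0"
    (is "?l \<longleftrightarrow> ?r")
proof
  show ?r if ?l
    using spheroid_homotopic_comp[OF fst_in_based_maps that] spheroid_homotopic_comp[OF snd_in_based_maps that]
    by blast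
next
  assume ?r
  then show ?l
    using homotopic_with_Pair[of "\<lambda>h. \<forall>x\<in>cube_boundary n. h x = x0" "cube n" X "fst \<circ> u" "fst \<circ> v"
        "\<lambda>h. \<forall>x\<in>cube_boundary n. h x = y0" Y "snd \<circ> u" "snd \<circ> v"
        "\<lambda>h. \<forall>x\<in>cube_boundary n. h x = (x0, y0)"]
    by (simp add: spheroid_homotopic_def)
qed

text \<open>This is \<open>\<pi>\<^sub>n(X \<times> Y) = \<pi>\<^sub>n(X) \<times> \<pi>\<^sub>n(Y)\<close>, read off from the components of spheroids and of their
  homotopies.\<close>

lemma induces_iso_map_prod:
  assumes f: "f \<in> based_maps X x0 X' x0'" and g: "g \<in> based_maps Y y0 Y' y0'"
    and x0: "x0 \<in> topspace X" and y0: "y0 \<in> topspace Y"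
    and "induces_iso n X x0 X' x0' f" and "induces_iso n Y y0 Y' y0' g"
  shows "induces_iso n (prod_topology X Y) (x0, y0) (prod_topology X' Y') (x0', y0') (map_prod f g)"
proof -
  have f_iso: "\<And>u v. u \<in> spheroids n X x0 \<Longrightarrow> v \<in> spheroids n X x0 \<Longrightarrow>
        (f \<circ> u, f \<circ> v) \<in> spheroid_homotopic n X' x0' \<Longrightarrow> (u, v) \<in> spheroid_homotopic n X x0"
      "\<And>w. w \<in> spheroids n X' x0' \<Longrightarrow> \<exists>u\<in>spheroids n X x0. (f \<circ> u, w) \<in> spheroid_homotopic n X' x0'"
    using assms(5) induces_iso_iff[OF f x0] by blast+
  have g_iso: "\<And>u v. u \<in> spheroids n Y y0 \<Longrightarrow> v \<in> spheroids n Y y0 \<Longrightarrow>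
        (g \<circ> u, g \<circ> v) \<in> spheroid_homotopic n Y' y0' \<Longrightarrow> (u, v) \<in> spheroid_homotopic n Y y0"
      "\<And>w. w \<in> spheroids n Y' y0' \<Longrightarrow> \<exists>u\<in>spheroids n Y y0. (g \<circ> u, w) \<in> spheroid_homotopic n Y' y0'"
    using assms(6) induces_iso_iff[OF g y0] by blast+
  have comps: "fst \<circ> (map_prod f g \<circ> u) = f \<circ> (fst \<circ> u)" "snd \<circ> (map_prod f g \<circ> u) = g \<circ> (snd \<circ> u)"
    for u :: "(nat \<Rightarrow> real) \<Rightarrow> _"
    by (simp_all add: fun_eq_iff)
  have xy0: "(x0, y0) \<in> topspace (prod_topology X Y)"
    using x0 y0 by simp
  show ?thesis
    unfolding induces_iso_iff[OF map_prod_in_based_maps[OF f g] xy0]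
  proof (intro conjI ballI impI)
    fix u v assume u: "u \<in> spheroids n (prod_topology X Y) (x0, y0)"
      and v: "v \<in> spheroids n (prod_topology X Y) (x0, y0)"
      and fg_uv: "(map_prod f g \<circ> u, map_prod f g \<circ> v) \<in> spheroid_homotopic n (prod_topology X' Y') (x0', y0')"
    have "(fst \<circ> u, fst \<circ> v) \<in> spheroid_homotopic n X x0"
      using fg_uv unfolding spheroid_homotopic_prod_iff comps
      by (intro f_iso(1) spheroid_comp[OF fst_in_based_maps u] spheroid_comp[OF fst_in_based_maps v]) simp
    moreover have "(snd \<circ> u, snd \<circ> v) \<in> spheroid_homotopic n Y y0"
      using fg_uv unfolding spheroid_homotopic_prod_iff comps
      by (intro g_iso(1) spheroid_comp[OF snd_in_based_maps u] spheroid_comp[OF snd_in_based_maps v]) simp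
    ultimately show "(u, v) \<in> spheroid_homotopic n (prod_topology X Y) (x0, y0)"
      by (simp add: spheroid_homotopic_prod_iff)
  next
    fix w assume w: "w \<in> spheroids n (prod_topology X' Y') (x0', y0')"
    obtain u where u: "u \<in> spheroids n X x0" "(f \<circ> u, fst \<circ> w) \<in> spheroid_homotopic n X' x0'"
      using f_iso(2)[OF spheroid_comp[OF fst_in_based_maps w]] by blast
    obtain v where v: "v \<in> spheroids n Y y0" "(g \<circ> v, snd \<circ> w) \<in> spheroid_homotopic n Y' y0'"
      using g_iso(2)[OF spheroid_comp[OF snd_in_based_maps w]] by blast
    let ?uv = "\<lambda>x. (u x, v x)"
    have "fst \<circ> ?uv = u" "snd \<circ> ?uv = v"
      by (simp_all add: fun_eq_iff)
    then have "?uv \<in> spheroids n (prod_topology X Y) (x0, y0)"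
      and "(map_prod f g \<circ> ?uv, w) \<in> spheroid_homotopic n (prod_topology X' Y') (x0', y0')"
      unfolding spheroid_homotopic_prod_iff comps
      using u v by (auto simp: spheroids_def continuous_map_pairwise)
    then show "\<exists>u\<in>spheroids n (prod_topology X Y) (x0, y0).
        (map_prod f g \<circ> u, w) \<in> spheroid_homotopic n (prod_topology X' Y') (x0', y0')"
      by blast
  qed
qed


section \<open>Comparison of self-closeness numbers\<close>

text \<open>Self-equivalences induce isomorphisms in all degrees, so equality of the two sets amounts to one
  inclusion; both conditions are homotopy invariant, so this inclusion can be tested on maps.\<close>

lemma A_sharp_eq_self_equivalences_iff:
  assumes x0: "x0 \<in> topspace X"
  shows "A_sharp k X x0 = self_equivalences X x0 \<longleftrightarrow>
    (\<forall>f\<in>based_maps X x0 X x0. (\<forall>i\<le>k. induces_iso i X x0 X x0 f) \<longrightarrow>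
       based_homotopy_equivalence X x0 X x0 f)"
proof -
  let ?R = "based_homotopic X x0 X x0"
  let ?iso = "\<lambda>f. \<forall>i\<le>k. induces_iso i X x0 X x0 f" and ?eqv = "based_homotopy_equivalence X x0 X x0"
  have invariant: "{F \<in> based_classes X x0 X x0. \<exists>f\<in>F. P f} = (\<lambda>f. ?R `` {f}) ` {f \<in> based_maps X x0 X x0. P f}"
    if P: "\<And>f g. (f, g) \<in> ?R \<Longrightarrow> P f \<Longrightarrow> P g" for P
  proof -
    have "(\<exists>g\<in>?R `` {f}. P g) \<longleftrightarrow> P f" if "f \<in> based_maps X x0 X x0" for f
      using that P equiv_class_self[OF equiv_based_homotopic] based_homotopic_sym
      by (metis Image_singleton_iff)
    then show ?thesis
      by (auto simp: based_classes_def quotient_def)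
  qed
  have iso_inv: "?iso g" if "(f, g) \<in> ?R" "?iso f" for f g
    using that induces_iso_homotopic[OF x0] by metis
  have eqv_inv: "?eqv g" if "(f, g) \<in> ?R" "?eqv f" for f g
    using that based_homotopy_equivalence_homotopic by metis
  let ?A = "{f \<in> based_maps X x0 X x0. ?iso f}" and ?B = "{f \<in> based_maps X x0 X x0. ?eqv f}"
  have A: "A_sharp k X x0 = (\<lambda>f. ?R `` {f}) ` ?A"
    unfolding A_sharp_def using iso_inv by (rule invariant)
  have B: "self_equivalences X x0 = (\<lambda>f. ?R `` {f}) ` ?B"
    unfolding self_equivalences_def using eqv_inv by (rule invariant)
  have "?B \<subseteq> ?A"
    using based_homotopy_equivalence_induces_iso[where Y = X, OF _ x0] by auto
  moreover have "?A \<subseteq> ?B" if eq: "A_sharp k X x0 = self_equivalences X x0"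
  proof
    fix f assume f: "f \<in> ?A"
    then have "?R `` {f} \<in> (\<lambda>f. ?R `` {f}) ` ?B"
      using eq unfolding A B by (metis (no_types, lifting) imageI)
    then obtain g where "g \<in> ?B" "?R `` {f} = ?R `` {g}"
      by blast
    moreover from this have "(g, f) \<in> ?R"
      using f equiv_class_self[OF equiv_based_homotopic, of f X x0 X x0] by auto
    ultimately show "f \<in> ?B"
      using f eqv_inv by blast
  qed
  ultimately have "A_sharp k X x0 = self_equivalences X x0 \<longleftrightarrow> ?A \<subseteq> ?B"
    unfolding A B by (metis (no_types, lifting) subset_antisym)
  then show ?thesis
    by blast
qed

lemma self_closeness_number_mono:
  assumes "\<And>k. A_sharp k Z z0 = self_equivalences Z z0 \<Longrightarrow> A_sharp k X x0 = self_equivalences X x0"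
  shows "self_closeness_number X x0 \<le> self_closeness_number Z z0"
proof (cases "\<exists>k. A_sharp k Z z0 = self_equivalences Z z0")
  case True
  from LeastI_ex[OF True]
  have "A_sharp (LEAST k. A_sharp k Z z0 = self_equivalences Z z0) X x0 = self_equivalences X x0"
    by (rule assms)
  then show ?thesis
    using True by (auto simp: self_closeness_number_def intro: Least_le)
next
  case False
  then show ?thesis
    by (simp add: self_closeness_number_def)
qed

text \<open>Here \<open>X\<close> plays the role of a factor of the product \<open>Z\<close>, and \<open>F\<close> that of the product of \<open>f\<close>
  with the identity of the other factor.\<close>

lemma self_closeness_number_retract:
  assumes x0: "x0 \<in> topspace X" and z0: "z0 \<in> topspace Z"
    and i: "i \<in> based_maps X x0 Z z0" and p: "p \<in> based_maps Z z0 X x0" and pi: "p \<circ> i = id"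
    and ext: "\<And>f. f \<in> based_maps X x0 X x0 \<Longrightarrow> \<exists>F\<in>based_maps Z z0 Z z0.
        F \<circ> i = i \<circ> f \<and> p \<circ> F = f \<circ> p \<and>
        (\<forall>n. induces_iso n X x0 X x0 f \<longrightarrow> induces_iso n Z z0 Z z0 F)"
  shows "self_closeness_number X x0 \<le> self_closeness_number Z z0"
proof (rule self_closeness_number_mono)
  fix k assume "A_sharp k Z z0 = self_equivalences Z z0"
  then have Z: "\<And>F. F \<in> based_maps Z z0 Z z0 \<Longrightarrow> \<forall>i\<le>k. induces_iso i Z z0 Z z0 F \<Longrightarrow>
      based_homotopy_equivalence Z z0 Z z0 F"
    using A_sharp_eq_self_equivalences_iff[OF z0] by blast
  show "A_sharp k X x0 = self_equivalences X x0"
    unfolding A_sharp_eq_self_equivalences_iff[OF x0]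
  proof (intro ballI impI)
    fix f assume f: "f \<in> based_maps X x0 X x0" and iso: "\<forall>i\<le>k. induces_iso i X x0 X x0 f"
    obtain F where F: "F \<in> based_maps Z z0 Z z0" "F \<circ> i = i \<circ> f" "p \<circ> F = f \<circ> p"
        "\<And>n. induces_iso n X x0 X x0 f \<Longrightarrow> induces_iso n Z z0 Z z0 F"
      using ext[OF f] by blast
    then have "based_homotopy_equivalence Z z0 Z z0 F"
      using Z iso by blast
    then show "based_homotopy_equivalence X x0 X x0 f"
      using based_homotopy_equivalence_retract[OF i p pi F(2,3)] by blast
  qed
qed

theorem theorem3:
  fixes X :: "'a topology" and x0 :: 'a
    and Y :: "'b topology" and y0 :: 'b
  assumes "CW_complex X" and "connected_space X" and "x0 \<in> topspace X"
    and "CW_complex Y" and "connected_space Y" and "y0 \<in> topspace Y"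
  shows "self_closeness_number (prod_topology X Y) (x0, y0)
           \<ge> max (self_closeness_number X x0) (self_closeness_number Y y0)"
proof -
  note x0 = assms(3) and y0 = assms(6)
  let ?Z = "prod_topology X Y" and ?z = "(x0, y0)"
  have z0: "?z \<in> topspace ?Z"
    using x0 y0 by simp
  have "self_closeness_number X x0 \<le> self_closeness_number ?Z ?z"
  proof (rule self_closeness_number_retract[OF x0 z0 _ fst_in_based_maps])
    show "(\<lambda>x. (x, y0)) \<in> based_maps X x0 ?Z ?z"
      using y0 by (simp add: based_maps_def continuous_map_pairwise o_def)
    fix f assume f: "f \<in> based_maps X x0 X x0"
    show "\<exists>F\<in>based_maps ?Z ?z ?Z ?z.
        F \<circ> (\<lambda>x. (x, y0)) = (\<lambda>x. (x, y0)) \<circ> f \<and> fst \<circ> F = f \<circ> fst \<and>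
        (\<forall>n. induces_iso n X x0 X x0 f \<longrightarrow> induces_iso n ?Z ?z ?Z ?z F)"
      using map_prod_in_based_maps[OF f id_in_based_maps]
        induces_iso_map_prod[OF f id_in_based_maps x0 y0] induces_iso_id[OF y0]
      by (intro bexI[of _ "map_prod f id"]) auto
  qed auto
  moreover have "self_closeness_number Y y0 \<le> self_closeness_number ?Z ?z"
  proof (rule self_closeness_number_retract[OF y0 z0 _ snd_in_based_maps])
    show "(\<lambda>y. (x0, y)) \<in> based_maps Y y0 ?Z ?z"
      using x0 by (simp add: based_maps_def continuous_map_pairwise o_def)
    fix f assume f: "f \<in> based_maps Y y0 Y y0"
    show "\<exists>F\<in>based_maps ?Z ?z ?Z ?z.
        F \<circ> (\<lambda>y. (x0, y)) = (\<lambda>y. (x0, y)) \<circ> f \<and> snd \<circ> F = f \<circ> snd \<and>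
        (\<forall>n. induces_iso n Y y0 Y y0 f \<longrightarrow> induces_iso n ?Z ?z ?Z ?z F)"
      using map_prod_in_based_maps[OF id_in_based_maps f]
        induces_iso_map_prod[OF id_in_based_maps f x0 y0] induces_iso_id[OF x0]
      by (intro bexI[of _ "map_prod id f"]) auto
  qed auto
  ultimately show ?thesis
    by simp
qed

end
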